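(* Let $d\ge 2$ be an integer. There exist constants $c_1,c_2,c_3>0$ depending only on $d$ such that for every $\varepsilon\in(0,1]$ and every integer $n\ge c_1\,\varepsilon^{(1-d)/2}$ there exists a set $S$ of $n$ points in $\mathbb{R}^d$ such that every Euclidean Steiner $(1+\varepsilon)$-spanner $N$ for $S$ has lightness at least $c_2\,\varepsilon^{-d/2}$ and sparsity at least $c_3\,\varepsilon^{(1-d)/2}$.
   Context: A Euclidean Steiner $(1+\varepsilon)$-spanner for a finite set $S\subset\mathbb{R}^d$ is a geometric graph $N$ whose vertex set contains $S$ and may contain arbitrary additional points of $\mathbb{R}^d$ (Steiner points), whose edges are straight line segments weighted by their Euclidean length, such that for all $a,b\in S$ the shortest-path distance in $N$ is at most $(1+\varepsilon)\|ab\|$. The weight $\|N\|$ is the sum of the Euclidean lengths of its edges. The lightness of $N$ is $\|N\|/\|\mathrm{MST}(S)\|$, where $\mathrm{MST}(S)$ is a Euclidean minimum spanning tree of $S$; the sparsity of $N$ is $|E(N)|/(|S|-1)$. *)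

theory Defs
  imports "HOL-Analysis.Analysis"
begin

text \<open>Geometric graphs in R^d: a finite vertex set V and a set E of edges,
each edge an unordered pair {a,b} (a \<noteq> b) of vertices, realised as the straight
segment between a and b, weighted by its Euclidean length.\<close>

definition edge_len :: "('a::metric_space) set \<Rightarrow> real" where
  "edge_len e = diameter e"

definition graph_weight :: "('a::metric_space) set set \<Rightarrow> real" where
  "graph_weight E = (\<Sum>e\<in>E. edge_len e)"

definition geom_graph :: "('a::metric_space) set \<Rightarrow> 'a set set \<Rightarrow> bool" where
  "geom_graph V E \<longleftrightarrow> finite V \<and> E \<subseteq> {{a, b} | a b. a \<in> V \<and> b \<in> V \<and> a \<noteq> b}"

fun is_walk :: "'a set set \<Rightarrow> 'a list \<Rightarrow> bool" where
  "is_walk E [] = False"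
| "is_walk E [x] = True"
| "is_walk E (x # y # xs) = ({x, y} \<in> E \<and> is_walk E (y # xs))"

fun walk_len :: "('a::metric_space) list \<Rightarrow> real" where
  "walk_len [] = 0"
| "walk_len [x] = 0"
| "walk_len (x # y # xs) = dist x y + walk_len (y # xs)"

definition graph_dist :: "('a::metric_space) set set \<Rightarrow> 'a \<Rightarrow> 'a \<Rightarrow> real" where
  "graph_dist E a b = Inf {walk_len p | p. is_walk E p \<and> hd p = a \<and> last p = b}"

definition connected_on :: "'a set \<Rightarrow> 'a set set \<Rightarrow> bool" where
  "connected_on V E \<longleftrightarrow> (\<forall>a\<in>V. \<forall>b\<in>V. \<exists>p. is_walk E p \<and> hd p = a \<and> last p = b)"

definition spanning_tree :: "('a::metric_space) set \<Rightarrow> 'a set set \<Rightarrow> bool" where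
  "spanning_tree S T \<longleftrightarrow> geom_graph S T \<and> connected_on S T \<and> card T = card S - 1"

definition mst_weight :: "('a::metric_space) set \<Rightarrow> real" where
  "mst_weight S = Inf (graph_weight ` {T. spanning_tree S T})"

definition steiner_spanner :: "('a::metric_space) set \<Rightarrow> real \<Rightarrow> 'a set \<Rightarrow> 'a set set \<Rightarrow> bool" where
  "steiner_spanner S eps V E \<longleftrightarrow> geom_graph V E \<and> S \<subseteq> V \<and>
     (\<forall>a\<in>S. \<forall>b\<in>S. (\<exists>p. is_walk E p \<and> hd p = a \<and> last p = b) \<and>
                     graph_dist E a b \<le> (1 + eps) * dist a b)"

definition lightness :: "('a::metric_space) set \<Rightarrow> 'a set set \<Rightarrow> real" where
  "lightness S E = graph_weight E / mst_weight S"

definition sparsity :: "'a set \<Rightarrow> 'a set set \<Rightarrow> real" where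
  "sparsity S E = real (card E) / (real (card S) - 1)"

end

theory Submission
  imports Defs
begin

text \<open>Take two parallel \<open>(d-1)\<close>-dimensional grids at distance 1 with spacing \<open>\<delta>\<close> a large
  multiple of \<open>sqrt eps\<close> and side length about 1. A \<open>(1 + 2 eps)\<close>-path between a bottom point \<open>a\<close> and a top
  point \<open>b\<close> spends at least 3/4 of \<open>dist a b\<close> on steps whose direction differs by
  \<open>O(sqrt eps)\<close> from that of \<open>b - a\<close>, and it stays within \<open>O(sqrt eps)\<close> of the segment. Such a step
  therefore determines \<open>a\<close> and \<open>b\<close> up to \<open>O(sqrt eps) < \<delta>\<close>, so no directed edge serves two
  pairs. Hence the spanner has weight and size proportional to the squared number of grid points, while
  a spanning tree costs only about \<open>\<delta>\<close> per point. For larger \<open>n\<close>, use many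
  far apart copies and put the few remaining points close to existing ones.\<close>

section \<open>Walks\<close>

lemma edge_len_pair: "edge_len {a, b} = dist a b"
proof -
  have "{a, b} \<times> {a, b} = {(a, a), (a, b), (b, a), (b, b)}" by auto
  then have "(\<lambda>(x, y). dist x y) ` ({a, b} \<times> {a, b}) = {0, dist a b}"
    by (simp add: dist_commute[of b a] insert_commute)
  then have "(SUP (x, y)\<in>{a, b} \<times> {a, b}. dist x y) = dist a b"
    by (simp add: cSup_eq_Max)
  then show ?thesis by (simp add: edge_len_def diameter_def)
qed

lemma geom_graph_finite: "geom_graph V E \<Longrightarrow> finite E"
  unfolding geom_graph_def by (rule finite_subset[of _ "Pow V"]) auto

lemma is_walk_append:
  "is_walk E (xs @ [x]) \<Longrightarrow> is_walk E (x # ys) \<Longrightarrow> is_walk E (xs @ x # ys)"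
  by (induction E xs rule: is_walk.induct) auto

lemma is_walk_split:
  "is_walk E (xs @ x # ys) \<Longrightarrow> is_walk E (xs @ [x]) \<and> is_walk E (x # ys)"
  by (induction xs rule: induct_list012) auto

lemma walk_len_split: "walk_len (xs @ x # ys) = walk_len (xs @ [x]) + walk_len (x # ys)"
  by (induction xs rule: induct_list012) auto

lemma walk_len_nonneg: "0 \<le> walk_len p"
  by (induction p rule: induct_list012) auto

lemma is_walk_rev: "is_walk E p \<Longrightarrow> is_walk E (rev p)"
proof (induction E p rule: is_walk.induct)
  case (3 E x y xs)
  then have "is_walk E (rev xs @ [y])" "is_walk E [y, x]" by (auto simp: insert_commute)
  then show ?case using is_walk_append by fastforce
qed auto

lemma is_walk_mono: "is_walk E p \<Longrightarrow> E \<subseteq> F \<Longrightarrow> is_walk F p"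
  by (induction E p rule: is_walk.induct) auto

text \<open>Cutting out the loop between two visits of a vertex never lengthens a walk. Once
  vertices do not repeat, no step occurs twice, so sums over the set of steps compute lengths and
  displacements.\<close>

lemma walk_to_distinct:
  assumes "is_walk E p"
  shows "\<exists>q. is_walk E q \<and> distinct q \<and> hd q = hd p \<and> last q = last p \<and> walk_len q \<le> walk_len p"
  using assms
proof (induction "length p" arbitrary: p rule: less_induct)
  case less
  show ?case
  proof (cases "distinct p")
    case False
    then obtain xs ys zs y where p: "p = xs @ [y] @ ys @ [y] @ zs"
      using not_distinct_decomp by blast
    let ?q = "xs @ y # zs"
    have w: "is_walk E (xs @ y # ys @ y # zs)" using less.prems p by simp
    have "is_walk E (xs @ [y])" "is_walk E (y # zs)"
      using is_walk_split[OF w] is_walk_split[of E "y # ys" y zs] by auto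
    then have "is_walk E ?q" by (rule is_walk_append)
    moreover have "walk_len ?q \<le> walk_len p"
      using walk_len_split[of xs y zs] walk_len_split[of xs y "ys @ y # zs"]
        walk_len_split[of "y # ys" y zs] walk_len_nonneg[of "y # ys @ [y]"] p by simp
    moreover have "hd ?q = hd p" "last ?q = last p" unfolding p by (auto simp: hd_append)
    ultimately show ?thesis using less.hyps[of ?q] p by fastforce
  qed (use less.prems in auto)
qed

text \<open>Pairs are ordered because the charging argument compares directions; orientation is
  forgotten only in \<open>sum_directed_le\<close>. Passing to a set loses multiplicities, which is
  harmless for distinct walks.\<close>

definition steps :: "'a list \<Rightarrow> ('a \<times> 'a) set" where
  "steps p = set (zip p (tl p))"

lemma steps_simps [simp]:
  "steps [] = {}" "steps [x] = {}" "steps (x # y # xs) = insert (x, y) (steps (y # xs))"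
  by (auto simp: steps_def)

lemma finite_steps [simp]: "finite (steps p)"
  by (simp add: steps_def)

lemma steps_in_set: "(x, y) \<in> steps p \<Longrightarrow> x \<in> set p \<and> y \<in> set p"
  by (induction p rule: induct_list012) auto

lemma steps_edge: "is_walk E p \<Longrightarrow> (x, y) \<in> steps p \<Longrightarrow> {x, y} \<in> E"
  by (induction E p rule: is_walk.induct) auto

lemma steps_neq: "distinct p \<Longrightarrow> (x, y) \<in> steps p \<Longrightarrow> x \<noteq> y"
  by (induction p rule: induct_list012) (auto dest: steps_in_set)

lemma sum_steps_dist:
  "distinct p \<Longrightarrow> (\<Sum>(x, y)\<in>steps p. dist x y) = walk_len p"
proof (induction p rule: induct_list012)
  case (3 x y xs)
  then have "(x, y) \<notin> steps (y # xs)" by (auto dest: steps_in_set)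
  with 3 show ?case by simp
qed auto

lemma sum_steps_diff:
  fixes p :: "'a::real_vector list"
  shows "distinct p \<Longrightarrow> p \<noteq> [] \<Longrightarrow> (\<Sum>(x, y)\<in>steps p. y - x) = last p - hd p"
proof (induction p rule: induct_list012)
  case (3 x y xs)
  then have "(x, y) \<notin> steps (y # xs)" by (auto dest: steps_in_set)
  with 3 show ?case by simp
qed auto

lemma dist_le_walk_len: "p \<noteq> [] \<Longrightarrow> dist (hd p) (last p) \<le> walk_len p"
proof (induction p rule: induct_list012)
  case (3 x y xs)
  then show ?case
    using dist_triangle[of x "last (y # xs)" y] by auto
qed auto

lemma dist_via_vertex_le_walk_len:
  assumes "v \<in> set p"
  shows "dist (hd p) v + dist v (last p) \<le> walk_len p"
proof -
  obtain xs ys where p: "p = xs @ v # ys" using split_list[OF assms] by blast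
  have "dist (hd p) v \<le> walk_len (xs @ [v])"
    using dist_le_walk_len[of "xs @ [v]"] p by (cases xs) auto
  moreover have "dist v (last p) \<le> walk_len (v # ys)"
    using dist_le_walk_len[of "v # ys"] p by simp
  ultimately show ?thesis using walk_len_split[of xs v ys] p by simp
qed

text \<open>\<open>graph_dist\<close> is an infimum. Doubling \<open>eps\<close> leaves strict room
  above it, so a concrete walk is obtained without showing that the infimum is attained.\<close>

lemma steiner_spanner_walk:
  assumes "steiner_spanner S eps V E" "a \<in> S" "b \<in> S" "a \<noteq> b" "0 < eps"
  obtains p where "is_walk E p" "distinct p" "hd p = a" "last p = b"
    "walk_len p \<le> (1 + 2 * eps) * dist a b"
proof -
  let ?X = "{walk_len p | p. is_walk E p \<and> hd p = a \<and> last p = b}"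
  have "?X \<noteq> {}" and "Inf ?X \<le> (1 + eps) * dist a b"
    using assms unfolding steiner_spanner_def graph_dist_def by blast+
  moreover have "(1 + eps) * dist a b < (1 + 2 * eps) * dist a b"
    using assms by simp
  ultimately obtain l where "l \<in> ?X" "l < (1 + 2 * eps) * dist a b"
    using cInf_lessD[of ?X "(1 + 2 * eps) * dist a b"] by (meson le_less_trans)
  then obtain p where p: "is_walk E p" "hd p = a" "last p = b"
      "walk_len p < (1 + 2 * eps) * dist a b"
    by blast
  from walk_to_distinct[OF p(1)] obtain q where
    "is_walk E q" "distinct q" "hd q = hd p" "last q = last p" "walk_len q \<le> walk_len p"
    by blast
  with p show thesis by (intro that[of q]) simp_all
qed

section \<open>Steps aligned with a segment\<close>

text \<open>Writing \<open>u\<close> for the direction of the segment, the defect \<open>norm v - inner v u\<close>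
  summed over all steps is at most \<open>2 eps\<close> times the length of the segment, so by Markov's inequality the
  steps with relative defect above \<open>8 eps\<close> carry at most a quarter of it.\<close>

definition aligned_steps :: "real \<Rightarrow> 'a::real_inner \<Rightarrow> 'a list \<Rightarrow> ('a \<times> 'a) set" where
  "aligned_steps eps w p =
     {(x, y) \<in> steps p. norm (y - x) - inner (y - x) (sgn w) \<le> 8 * eps * norm (y - x)}"

lemma inner_sgn_self: "inner w (sgn w) = norm (w :: 'a::real_inner)"
  by (cases "w = 0") (auto simp: sgn_div_norm power2_norm_eq_inner[symmetric] power2_eq_square)

lemma inner_sgn_le: "inner v (sgn w) \<le> norm (v :: 'a::real_inner)"
  using norm_cauchy_schwarz[of v "sgn w"] by (auto simp: norm_sgn split: if_splits)

lemma aligned_steps_length: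
  fixes p :: "'a::real_inner list"
  assumes "distinct p" "p \<noteq> []" "hd p = a" "last p = b" "0 < eps"
    "walk_len p \<le> (1 + 2 * eps) * dist a b"
  shows "(\<Sum>(x, y)\<in>aligned_steps eps (b - a) p. dist x y) \<ge> 3 / 4 * dist a b"
proof -
  let ?w = "b - a" and ?G = "aligned_steps eps (b - a) p"
  let ?B = "steps p - ?G"
  define f where "f = (\<lambda>(x, y). norm (y - x) - inner (y - x) (sgn ?w))"
  define l where "l = (\<lambda>(x, y::'a). dist x y)"
  have G: "?G \<subseteq> steps p" by (auto simp: aligned_steps_def)
  have L: "sum l (steps p) = walk_len p"
    using sum_steps_dist[OF assms(1)] by (simp add: l_def)
  \<comment> \<open>Displacements telescope, so the signed progress in the direction of the segment
    adds up to exactly \<open>dist a b\<close>.\<close>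
  have "(\<Sum>(x, y)\<in>steps p. inner (y - x) (sgn ?w)) = inner (\<Sum>(x, y)\<in>steps p. y - x) (sgn ?w)"
    by (simp add: inner_sum_left case_prod_unfold)
  also have "\<dots> = dist a b"
    using sum_steps_diff[OF assms(1,2)] assms(3,4) inner_sgn_self[of ?w]
    by (simp add: dist_norm norm_minus_commute)
  finally have I: "(\<Sum>(x, y)\<in>steps p. inner (y - x) (sgn ?w)) = dist a b" .
  have "sum f (steps p) = sum l (steps p) - (\<Sum>(x, y)\<in>steps p. inner (y - x) (sgn ?w))"
    unfolding sum_subtractf[symmetric] f_def l_def
    by (rule sum.cong) (auto simp: dist_norm norm_minus_commute)
  then have F: "sum f (steps p) \<le> 2 * eps * dist a b"
    using I L assms(6) by (simp add: algebra_simps)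
  have f0: "f s \<ge> 0" for s
    unfolding f_def using inner_sgn_le by (auto split: prod.splits)
  have "8 * eps * sum l ?B = (\<Sum>s\<in>?B. 8 * eps * l s)"
    by (simp add: sum_distrib_left)
  also have "\<dots> \<le> sum f ?B"
    by (rule sum_mono) (auto simp: aligned_steps_def f_def l_def dist_norm norm_minus_commute)
  also have "\<dots> \<le> sum f (steps p)"
    by (rule sum_mono2) (auto simp: f0)
  finally have "8 * eps * sum l ?B \<le> 2 * eps * dist a b" using F by linarith
  then have "eps * (4 * sum l ?B) \<le> eps * dist a b" by simp
  then have "4 * sum l ?B \<le> dist a b" using assms(5) by simp
  moreover have "sum l (steps p) = sum l ?B + sum l ?G"
    by (rule sum.subset_diff[OF G]) simp
  moreover have "dist a b \<le> walk_len p" using dist_le_walk_len assms by blast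
  ultimately show ?thesis using L unfolding l_def by linarith
qed

text \<open>The part \<open>y\<close> of \<open>x\<close> orthogonal to the segment satisfies
  \<open>(norm y)^2 = (norm x - t) * (norm x + t)\<close>, where the first factor is at most the
  detour. The vector \<open>e\<close> plays the role of a vertical direction: the deviation is
  measured inside the slice of points at the height of \<open>p\<close>, which makes it comparable
  for two segments that start at the same height.\<close>

lemma near_line_of_short_detour:
  fixes a b p e :: "'a::real_inner"
  assumes "norm (p - a) + norm (b - p) \<le> (1 + 2 * eps) * norm (b - a)"
    and eps: "0 \<le> eps" "eps \<le> 1" and e: "inner e (b - a) = 1" "norm e = 1"
    and len: "norm (b - a) \<le> B"
  shows "norm (p - a - inner e (p - a) *\<^sub>R (b - a)) \<le> 4 * sqrt eps * B * (1 + B)"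
proof -
  define w where "w = b - a"
  define x where "x = p - a"
  define t where "t = inner x (sgn w)"
  define y where "y = x - t *\<^sub>R sgn w"
  have w0: "w \<noteq> 0" using e w_def by auto
  have s1: "inner (sgn w) (sgn w) = 1" using w0 by (simp add: norm_sgn power2_norm_eq_inner[symmetric])
  \<comment> \<open>The progress still missing at \<open>p\<close> is at most the length of the
    second leg, so the first leg wastes no more than the total detour.\<close>
  have "norm w - t = inner (b - p) (sgn w)"
    unfolding t_def inner_sgn_self[symmetric] w_def x_def by (simp add: inner_diff_left)
  also have "\<dots> \<le> norm (b - p)" by (rule inner_sgn_le)
  finally have "norm x - t \<le> 2 * eps * norm w"
    using assms(1) unfolding w_def x_def by (simp add: algebra_simps)
  moreover have x3: "norm x \<le> 3 * norm w"
  proof -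
    have "(1 + 2 * eps) * norm w \<le> 3 * norm w" using eps by (intro mult_right_mono) auto
    then show ?thesis using assms(1) norm_ge_zero[of "b - p"] unfolding w_def x_def by linarith
  qed
  moreover have "t \<le> norm x" "- norm x \<le> t"
    using inner_sgn_le[of x w] inner_sgn_le[of "- x" w] by (auto simp: t_def)
  ultimately have "(norm x - t) * (norm x + t) \<le> (2 * eps * norm w) * (6 * norm w)"
    using eps by (intro mult_mono) auto
  moreover have "(norm y)\<^sup>2 = (norm x - t) * (norm x + t)"
    unfolding y_def power2_norm_eq_inner
    using t_def inner_commute[of "sgn w" x] dot_square_norm[of x]
    by (simp add: inner_diff_left inner_diff_right s1 algebra_simps power2_eq_square)
  \<comment> \<open>The factor 12 is rounded up to the square 16.\<close>
  moreover have "(2 * eps * norm w) * (6 * norm w) \<le> 16 * (eps * (norm w)\<^sup>2)"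
    using eps by (simp add: power2_eq_square)
  ultimately have "(norm y)\<^sup>2 \<le> 16 * (eps * (norm w)\<^sup>2)" by linarith
  also have "\<dots> = (4 * sqrt eps * norm w)\<^sup>2" using eps by (simp add: power_mult_distrib)
  finally have "norm y \<le> 4 * sqrt eps * norm w"
    using eps by (simp add: power2_le_iff_abs_le)
  also have "\<dots> \<le> 4 * sqrt eps * B"
    using len eps unfolding w_def by (intro mult_left_mono) auto
  finally have y: "norm y \<le> 4 * sqrt eps * B" .
  have sw: "sgn w = (1 / norm w) *\<^sub>R w" by (simp add: sgn_div_norm divide_inverse)
  \<comment> \<open>Change from the orthogonal projection to the projection along \<open>w\<close>
    onto the kernel of \<open>inner e\<close>. Since \<open>x\<close> and \<open>y\<close> differ by
    a multiple of \<open>w\<close> and \<open>inner e w = 1\<close>, both have the same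
    image.\<close>
  have "inner e x = t / norm w + inner e y"
    using e unfolding y_def sw by (simp add: inner_diff_right w_def)
  then have "x - inner e x *\<^sub>R w = y - inner e y *\<^sub>R w"
    unfolding y_def by (simp add: sw algebra_simps)
  also have "norm \<dots> \<le> norm y + \<bar>inner e y\<bar> * norm w"
    using norm_triangle_ineq4[of y "inner e y *\<^sub>R w"] by simp
  also have "\<dots> \<le> norm y + norm y * B"
    using Cauchy_Schwarz_ineq2[of e y] e len unfolding w_def by (intro add_left_mono mult_mono) auto
  also have "\<dots> = norm y * (1 + B)" by (simp add: algebra_simps)
  also have "\<dots> \<le> 4 * sqrt eps * B * (1 + B)"
    using y len norm_ge_zero[of "b - a"] by (intro mult_right_mono) linarith+
  finally show ?thesis unfolding w_def x_def .
qed

text \<open>The hypothesis says that the cosine of the angle is at least \<open>1 - 8 * eps\<close>,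
  and the squared chord between unit vectors is 2 minus twice the cosine.\<close>

lemma norm_sgn_diff_le:
  fixes v w :: "'a::real_inner"
  assumes "norm v - inner v (sgn w) \<le> 8 * eps * norm v" "v \<noteq> 0" "w \<noteq> 0" "0 \<le> eps"
  shows "norm (sgn v - sgn w) \<le> 4 * sqrt eps"
proof -
  have "norm v * (1 - inner (sgn v) (sgn w)) \<le> norm v * (8 * eps)"
  proof -
    have "norm v * inner (sgn v) (sgn w) = inner v (sgn w)"
      using assms(2) by (simp add: sgn_div_norm[of v])
    then show ?thesis using assms(1) by (simp add: right_diff_distrib mult.left_commute mult.commute)
  qed
  then have "1 - inner (sgn v) (sgn w) \<le> 8 * eps" using assms by simp
  moreover have "(norm (sgn v - sgn w))\<^sup>2 = 2 - 2 * inner (sgn v) (sgn w)"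
  proof -
    have "inner (sgn v) (sgn v) = 1" "inner (sgn w) (sgn w) = 1"
      using assms by (simp_all add: dot_square_norm norm_sgn)
    then show ?thesis
      unfolding power2_norm_eq_inner inner_diff_left inner_diff_right
      by (simp add: inner_commute[of "sgn w" "sgn v"])
  qed
  ultimately have "(norm (sgn v - sgn w))\<^sup>2 \<le> (4 * sqrt eps)\<^sup>2"
    using assms(4) by (simp add: power_mult_distrib)
  then show ?thesis by (rule power2_le_imp_le) (simp add: assms(4))
qed

text \<open>Vectors of height 1 are determined by their direction, because
  \<open>norm w = 1 / inner e (sgn w)\<close>. The difference splits into a change of direction and
  a change of length, both controlled by \<open>c\<close>.\<close>

lemma slope_diff_le:
  fixes w w' e :: "'a::real_inner"
  assumes "norm (sgn w - sgn w') \<le> c" "inner e w = 1" "inner e w' = 1" "norm e = 1"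
    "norm w \<le> B" "norm w' \<le> B" 
  shows "norm (w - w') \<le> c * B * (1 + B)"
proof -
  have w0: "w \<noteq> 0" "w' \<noteq> 0" using assms by auto
  have B0: "0 \<le> B" using assms(5) norm_ge_zero[of w] by linarith
  have c0: "0 \<le> c" using assms(1) norm_ge_zero order_trans by blast
  have e: "inner e (sgn w) = 1 / norm w" "inner e (sgn w') = 1 / norm w'"
    using assms by (auto simp: sgn_div_norm divide_inverse)
  have "\<bar>inner e (sgn w - sgn w')\<bar> \<le> norm (sgn w - sgn w')"
    using Cauchy_Schwarz_ineq2[of e "sgn w - sgn w'"] assms by simp
  then have "\<bar>1 / norm w - 1 / norm w'\<bar> \<le> c" using assms(1) by (simp add: inner_diff_right e)
  then have "norm w * norm w' * \<bar>1 / norm w - 1 / norm w'\<bar> \<le> B * B * c"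
    using assms B0 by (intro mult_mono) auto
  moreover have "norm w * norm w' * \<bar>1 / norm w - 1 / norm w'\<bar> =
      \<bar>norm w * norm w' * (1 / norm w - 1 / norm w')\<bar>"
    by (simp add: abs_mult)
  moreover have "norm w * norm w' * (1 / norm w - 1 / norm w') = norm w' - norm w"
    using w0 by (simp add: field_simps)
  ultimately have d: "\<bar>norm w - norm w'\<bar> \<le> B * B * c" by (simp add: abs_minus_commute)
  have r: "w = norm w *\<^sub>R sgn w" "w' = norm w' *\<^sub>R sgn w'" using w0 by (auto simp: sgn_div_norm)
  have "w - w' = norm w *\<^sub>R (sgn w - sgn w') + (norm w - norm w') *\<^sub>R sgn w'"
    using r by (simp add: algebra_simps)
  then have "norm (w - w') \<le> norm w * norm (sgn w - sgn w') + \<bar>norm w - norm w'\<bar> * norm (sgn w')"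
    using norm_triangle_ineq by (metis norm_scaleR abs_norm_cancel)
  also have "\<dots> \<le> B * c + B * B * c"
    using assms d B0 w0 by (simp add: norm_sgn add_mono mult_mono)
  finally show ?thesis by (simp add: algebra_simps)
qed

text \<open>A shared step is nearly parallel to both segments, so \<open>w\<close> and
  \<open>w'\<close> are close. Its start \<open>x\<close> lies near both \<open>a + z w\<close> and
  \<open>a' + z w'\<close> with the same \<open>z\<close>, as \<open>a\<close> and \<open>a'\<close>
  have equal height. Hence \<open>a\<close> is close to \<open>a'\<close>, and adding
  \<open>w\<close> and \<open>w'\<close> gives the claim for \<open>b\<close> and
  \<open>b'\<close>.\<close>

lemma aligned_steps_endpoints_close:
  fixes a b a' b' e :: "'a::real_inner"
  assumes p: "distinct p" "hd p = a" "last p = b"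
      "walk_len p \<le> (1 + 2 * eps) * dist a b"
    and p': "hd p' = a'" "last p' = b'"
      "walk_len p' \<le> (1 + 2 * eps) * dist a' b'"
    and s: "(x, y) \<in> aligned_steps eps (b - a) p" "(x, y) \<in> aligned_steps eps (b' - a') p'"
    and eps: "0 < eps" "eps \<le> 1"
    and e: "inner e (b - a) = 1" "inner e (b' - a') = 1" "norm e = 1" "inner e a = inner e a'"
    and B: "dist a b \<le> B" "dist a' b' \<le> B" "0 < B"
  shows "dist a a' < 24 * B * (1 + B)\<^sup>2 * sqrt eps"
    and "dist b b' < 24 * B * (1 + B)\<^sup>2 * sqrt eps"
proof -
  define w w' z where "w = b - a" "w' = b' - a'" "z = inner e (x - a)"
  have n: "norm w \<le> B" "norm w' \<le> B" using B by (auto simp: w_w'_z_def dist_norm norm_minus_commute)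
  have w0: "w \<noteq> 0" "w' \<noteq> 0" using e by (auto simp: w_w'_z_def)
  have xy: "x \<noteq> y" using s(1) steps_neq[OF p(1)] unfolding aligned_steps_def by blast
  have x: "x \<in> set p" "x \<in> set p'" using s steps_in_set by (fastforce simp: aligned_steps_def)+
  have m: "norm (x - a) + norm (b - x) \<le> (1 + 2 * eps) * norm w"
      "norm (x - a') + norm (b' - x) \<le> (1 + 2 * eps) * norm w'"
    using dist_via_vertex_le_walk_len[OF x(1)] dist_via_vertex_le_walk_len[OF x(2)] p p'
    by (auto simp: w_w'_z_def dist_norm norm_minus_commute)
  have "norm (sgn (y - x) - sgn w) \<le> 4 * sqrt eps" "norm (sgn (y - x) - sgn w') \<le> 4 * sqrt eps"
    using s xy w0 eps by (auto intro!: norm_sgn_diff_le simp: aligned_steps_def w_w'_z_def)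
  then have "norm (sgn w - sgn w') \<le> 8 * sqrt eps"
    using norm_triangle_ineq4[of "sgn (y - x) - sgn w'" "sgn (y - x) - sgn w"] by simp
  then have d: "norm (w - w') \<le> 8 * sqrt eps * B * (1 + B)"
    using slope_diff_le[of w w' "8 * sqrt eps" e B] e n by (simp add: w_w'_z_def)
  have z': "z = inner e (x - a')" using e by (simp add: w_w'_z_def inner_diff_right)
  have l: "norm (x - a - z *\<^sub>R w) \<le> 4 * sqrt eps * B * (1 + B)"
    "norm (x - a' - z *\<^sub>R w') \<le> 4 * sqrt eps * B * (1 + B)"
    using near_line_of_short_detour[of x a b eps e B] near_line_of_short_detour[of x a' b' eps e B]
      m n eps e z' by (auto simp: w_w'_z_def)
  have "\<bar>z\<bar> \<le> norm (x - a)"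
    using Cauchy_Schwarz_ineq2[of e "x - a"] e by (simp add: w_w'_z_def)
  moreover have "(1 + 2 * eps) * norm w \<le> 3 * B" using eps n by (intro mult_mono) auto
  ultimately have z: "\<bar>z\<bar> \<le> 3 * B" using m norm_ge_zero[of "b - x"] by linarith
  let ?q = "sqrt eps * B * (1 + B)"
  define q q' where "q = x - a - z *\<^sub>R w" "q' = x - a' - z *\<^sub>R w'"
  have "a' - a = (q - q') + z *\<^sub>R (w - w')"
    by (simp add: q_q'_def algebra_simps)
  then have "norm (a' - a) \<le> norm (q - q') + \<bar>z\<bar> * norm (w - w')"
    by (metis norm_triangle_ineq norm_scaleR)
  also have "norm (q - q') \<le> norm q + norm q'" by (rule norm_triangle_ineq4)
  also have "\<bar>z\<bar> * norm (w - w') \<le> (3 * B) * (8 * sqrt eps * B * (1 + B))"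
    using z d B by (intro mult_mono) auto
  finally have A: "norm (a' - a) \<le> 8 * ?q + 24 * (?q * B)"
    using l by (simp add: q_q'_def algebra_simps)
  have "b' - b = (a' - a) - (w - w')" by (simp add: w_w'_z_def)
  then have Bd: "norm (b' - b) \<le> norm (a' - a) + norm (w - w')"
    by (metis norm_triangle_ineq4)
  \<comment> \<open>The estimates obtained are \<open>8 * ?q + 24 * (?q * B)\<close> for
    \<open>a\<close> and \<open>8 * ?q\<close> more for \<open>b\<close>, both strictly below this
    value. The grid spacing is later set equal to it with \<open>B = d\<close>.\<close>
  have k: "24 * B * (1 + B)\<^sup>2 * sqrt eps = 24 * ?q + 24 * (?q * B)"
    by (simp add: power2_eq_square algebra_simps)
  have "?q > 0" using B eps by (auto intro!: mult_pos_pos)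
  moreover have "8 * sqrt eps * B * (1 + B) = 8 * ?q" by simp
  ultimately show "dist a a' < 24 * B * (1 + B)\<^sup>2 * sqrt eps"
    "dist b b' < 24 * B * (1 + B)\<^sup>2 * sqrt eps"
    using A Bd d k by (auto simp: dist_norm norm_minus_commute)
qed

section \<open>Spanning trees and edge sums\<close>

lemma connected_on_root:
  assumes "\<And>x. x \<in> V \<Longrightarrow> \<exists>p. is_walk E p \<and> hd p = x \<and> last p = r"
  shows "connected_on V E"
  unfolding connected_on_def
proof (intro ballI)
  fix a b assume "a \<in> V" "b \<in> V"
  then obtain p q where p: "is_walk E p" "hd p = a" "last p = r"
    and q: "is_walk E q" "hd q = b" "last q = r"
    using assms by metis
  have "p \<noteq> []" "q \<noteq> []" using p q by auto
  then obtain p' q' where pq: "p = p' @ [r]" "rev q = r # q'"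
    using p q by (metis append_butlast_last_id hd_rev list.exhaust_sel rev_is_Nil_conv)
  have "is_walk E (p' @ r # q')"
    using is_walk_append is_walk_rev[OF q(1)] p pq by metis
  moreover have "hd (p' @ r # q') = a" using p pq by (cases p') auto
  moreover have "last (p' @ r # q') = b"
    using q pq \<open>q \<noteq> []\<close> by (metis last_appendR last_rev list.distinct(1))
  ultimately show "\<exists>p. is_walk E p \<and> hd p = a \<and> last p = b" by blast
qed

lemma spanning_tree_insert:
  assumes T: "spanning_tree S T" and S: "finite S" "y \<in> S" "x \<notin> S"
  shows "\<exists>T'. spanning_tree (insert x S) T' \<and> graph_weight T' = graph_weight T + dist x y"
proof -
  let ?T = "insert {x, y} T"
  have g: "geom_graph S T" and c: "connected_on S T" and k: "card T = card S - 1"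
    using T by (auto simp: spanning_tree_def)
  have f: "finite T" using geom_graph_finite g by blast
  have n: "{x, y} \<notin> T" using g S by (auto simp: geom_graph_def doubleton_eq_iff)
  have "card S \<ge> 1" using S by (metis One_nat_def Suc_leI card_gt_0_iff empty_iff)
  then have "card ?T = card (insert x S) - 1" using k f n S by simp
  moreover have "geom_graph (insert x S) ?T" using g S unfolding geom_graph_def by blast
  moreover have "connected_on (insert x S) ?T"
  proof (rule connected_on_root[where r = y])
    fix v assume "v \<in> insert x S"
    then consider "v = x" | "v \<in> S" by auto
    then show "\<exists>p. is_walk ?T p \<and> hd p = v \<and> last p = y"
    proof cases
      case 1 then show ?thesis by (intro exI[of _ "[x, y]"]) auto
    next
      case 2
      then obtain p where "is_walk T p" "hd p = v" "last p = y"
        using c S unfolding connected_on_def by blast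
      then show ?thesis using is_walk_mono[of T p ?T] by blast
    qed
  qed
  moreover have "graph_weight ?T = graph_weight T + dist x y"
    using f n by (simp add: graph_weight_def edge_len_pair)
  ultimately show ?thesis unfolding spanning_tree_def by blast
qed

lemma spanning_tree_singleton: "spanning_tree {x} {}"
  by (auto simp: spanning_tree_def geom_graph_def connected_on_def intro!: exI[of _ "[x]"])

text \<open>A point of maximal rank is nobody's parent, so it can be removed, a tree built on the
  rest by induction, and the point attached again as a leaf.\<close>

lemma spanning_tree_of_parents:
  fixes P :: "'i \<Rightarrow> 'a::metric_space" and rank :: "'i \<Rightarrow> nat"
  assumes "finite I" "inj_on P I" "r \<in> I"
    and "\<And>x. x \<in> I - {r} \<Longrightarrow> par x \<in> I \<and> rank (par x) < rank x \<and> dist (P x) (P (par x)) \<le> c x"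
  shows "\<exists>T. spanning_tree (P ` I) T \<and> graph_weight T \<le> (\<Sum>x\<in>I - {r}. c x)"
  using assms
proof (induction "card I" arbitrary: I rule: less_induct)
  case less
  show ?case
  proof (cases "I = {r}")
    case True
    then show ?thesis
      using spanning_tree_singleton[of "P r"] by (auto simp: graph_weight_def intro!: exI[of _ "{}"])
  next
    case False
    with less.prems have "Max (rank ` (I - {r})) \<in> rank ` (I - {r})"
      by (intro Max_in) auto
    then obtain m where m: "m \<in> I - {r}" "rank m = Max (rank ` (I - {r}))" by (metis imageE)
    have mx: "rank x \<le> rank m" if "x \<in> I - {r}" for x
      using that m less.prems by simp
    let ?J = "I - {m}"
    have sub: "?J - {r} \<subseteq> I - {r}" by auto
    have "\<exists>T. spanning_tree (P ` ?J) T \<and> graph_weight T \<le> (\<Sum>x\<in>?J - {r}. c x)"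
    proof (rule less.hyps)
      show "card ?J < card I" using m less.prems by (intro psubset_card_mono) auto
      show "inj_on P ?J" using less.prems(2) by (rule inj_on_subset) auto
      fix x assume x: "x \<in> ?J - {r}"
      then have "par x \<noteq> m" using less.prems(4)[of x] mx[of x] by force
      then show "par x \<in> ?J \<and> rank (par x) < rank x \<and> dist (P x) (P (par x)) \<le> c x"
        using less.prems(4)[of x] x by auto
    qed (use less.prems m in auto)
    then obtain T where T: "spanning_tree (P ` ?J) T" "graph_weight T \<le> (\<Sum>x\<in>?J - {r}. c x)" by blast
    have pm: "par m \<in> ?J" "dist (P m) (P (par m)) \<le> c m" using less.prems(4)[OF m(1)] by auto
    have "P m \<notin> P ` ?J" using less.prems(2) m by (auto simp: inj_on_def)
    then obtain T' where "spanning_tree (insert (P m) (P ` ?J)) T'"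
      "graph_weight T' = graph_weight T + dist (P m) (P (par m))"
      using spanning_tree_insert[OF T(1), of "P (par m)" "P m"] pm less.prems by auto
    moreover have "insert (P m) (P ` ?J) = P ` I" using m by auto
    moreover have "(\<Sum>x\<in>I - {r}. c x) = c m + (\<Sum>x\<in>?J - {r}. c x)"
    proof -
      have "I - {r} - {m} = ?J - {r}" by auto
      then show ?thesis using sum.remove[of "I - {r}" m c] m less.prems by simp
    qed
    ultimately show ?thesis using T(2) pm by fastforce
  qed
qed

text \<open>Pads a point set to a prescribed cardinality at small cost: a ball is infinite, so a new
  point within \<open>\<delta>\<close> of an old one always exists.\<close>

lemma spanning_tree_add_points:
  fixes S :: "'a::euclidean_space set" and \<delta> :: real
  assumes "spanning_tree S T" "finite S" "S \<noteq> {}" "0 < \<delta>"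
  shows "\<exists>S' T'. S \<subseteq> S' \<and> finite S' \<and> card S' = card S + r \<and> spanning_tree S' T' \<and>
    graph_weight T' \<le> graph_weight T + r * \<delta>"
proof (induction r)
  case 0
  then show ?case using assms by auto
next
  case (Suc r)
  then obtain S' T' where S': "S \<subseteq> S'" "finite S'" "card S' = card S + r" "spanning_tree S' T'"
    "graph_weight T' \<le> graph_weight T + r * \<delta>" by blast
  obtain y where y: "y \<in> S'" using S' assms by auto
  have "infinite (ball y \<delta>)"
    using uncountable_ball[OF assms(4), of y] countable_finite by metis
  then obtain x where x: "x \<in> ball y \<delta>" "x \<notin> S'"
    using S' by (meson finite_subset subsetI)
  obtain T'' where "spanning_tree (insert x S') T''" "graph_weight T'' = graph_weight T' + dist x y"
    using spanning_tree_insert[OF S'(4,2) y x(2)] by blast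
  then show ?case using S' x
    by (intro exI[of _ "insert x S'"] exI[of _ T'']) (auto simp: dist_commute algebra_simps)
qed

text \<open>There are finitely many spanning trees, so the infimum is a minimum. This gives strict
  positivity, needed because lightness divides by it; two points force at least one edge.\<close>

lemma mst_weight_bounds:
  assumes T: "spanning_tree S T" and S: "finite S" "card S \<ge> 2"
  shows "0 < mst_weight S" "mst_weight S \<le> graph_weight T"
proof -
  let ?W = "graph_weight ` {T. spanning_tree S T}"
  have "{T. spanning_tree S T} \<subseteq> Pow (Pow S)"
    by (auto simp: spanning_tree_def geom_graph_def)
  then have fin: "finite ?W" using S by (meson finite_Pow_iff finite_imageI finite_subset)
  have ne: "?W \<noteq> {}" using T by auto
  have eq: "mst_weight S = Min ?W" unfolding mst_weight_def using cInf_eq_Min fin ne by blast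
  show "mst_weight S \<le> graph_weight T" unfolding eq using fin T by (intro Min_le) auto
  have "graph_weight U > 0" if "spanning_tree S U" for U
  proof -
    have g: "geom_graph S U" "card U = card S - 1" using that by (auto simp: spanning_tree_def)
    have "finite U" "U \<noteq> {}" using g geom_graph_finite S by auto
    moreover have "edge_len e > 0" if "e \<in> U" for e
      using that g by (auto simp: geom_graph_def edge_len_pair)
    ultimately show ?thesis unfolding graph_weight_def by (intro sum_pos) auto
  qed
  then show "0 < mst_weight S" unfolding eq using Min_in[OF fin ne] by auto
qed

text \<open>An edge carries at most two orientations. With \<open>h\<close> the edge length this
  bounds the weight from below, with \<open>h = 1\<close> the number of edges.\<close>

lemma sum_directed_le:
  fixes h :: "'a set \<Rightarrow> real"
  assumes "finite E" and G: "G \<subseteq> {(x, y). {x, y} \<in> E}" and h: "\<And>e. e \<in> E \<Longrightarrow> h e \<ge> 0"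
  shows "(\<Sum>(x, y)\<in>G. h {x, y}) \<le> 2 * (\<Sum>e\<in>E. h e)"
proof -
  define g where "g = (\<lambda>(x, y). {x, y::'a})"
  have fib: "card {s \<in> G. g s = e} \<le> 2 \<and> finite {s \<in> G. g s = e}" if "e \<in> E" for e
  proof (cases "\<exists>x y. e = {x, y}")
    case True
    then obtain x y where e: "e = {x, y}" by blast
    have "s \<in> {(x, y), (y, x)}" if "g s = e" for s
      using that unfolding e g_def by (cases s) (simp add: doubleton_eq_iff)
    then have sub: "{s \<in> G. g s = e} \<subseteq> {(x, y), (y, x)}" by blast
    have "card {(x, y), (y, x)} \<le> 2" using card_length[of "[(x, y), (y, x)]"] by simp
    moreover have "card {s \<in> G. g s = e} \<le> card {(x, y), (y, x)}"
      by (rule card_mono[OF _ sub]) simp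
    moreover have "finite {s \<in> G. g s = e}" by (rule finite_subset[OF sub]) simp
    ultimately show ?thesis by linarith
  next
    case False
    then have "{s \<in> G. g s = e} = {}" by (auto simp: g_def)
    then show ?thesis by (metis card.empty finite.emptyI zero_le)
  qed
  have "G \<subseteq> (\<Union>e\<in>E. {s \<in> G. g s = e})" using G by (auto simp: g_def)
  then have "finite G" using finite_subset fib assms(1) by blast
  moreover have "g ` G \<subseteq> E" using G by (auto simp: g_def)
  ultimately have "(\<Sum>s\<in>G. h (g s)) = (\<Sum>e\<in>E. \<Sum>s | s \<in> G \<and> g s = e. h (g s))"
    using sum.group[of G E g "\<lambda>s. h (g s)"] assms(1) by simp
  also have "\<dots> = (\<Sum>e\<in>E. real (card {s \<in> G. g s = e}) * h e)"
    by (intro sum.cong) auto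
  also have "\<dots> \<le> (\<Sum>e\<in>E. 2 * h e)"
    using fib h by (intro sum_mono mult_right_mono) force+
  finally show ?thesis by (simp add: g_def sum_distrib_left case_prod_unfold)
qed

section \<open>Stacked pairs of grids\<close>

text \<open>The \<open>j\<close>-th pair of layers has indices \<open>2 * j\<close> and \<open>2 * j + 1\<close> along the coordinate \<open>z\<close>
  and lies at heights \<open>j * D\<close> and \<open>j * D + 1\<close>.\<close>

definition height :: "real \<Rightarrow> nat \<Rightarrow> real" where
  "height D m = real (m div 2) * D + real (m mod 2)"

definition grid_point :: "'d \<Rightarrow> real \<Rightarrow> real \<Rightarrow> ('d \<Rightarrow> nat) \<Rightarrow> real^'d" where
  "grid_point z \<delta> D f = (\<chi> i. if i = z then height D (f i) else \<delta> * real (f i))"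

text \<open>The coordinate \<open>z\<close> counts layers. With a single layer the set describes one
  horizontal grid, whose entry 0 at \<open>z\<close> is later overwritten by the wanted
  layer.\<close>

definition grid_index :: "'d \<Rightarrow> nat \<Rightarrow> nat \<Rightarrow> ('d \<Rightarrow> nat) set" where
  "grid_index z m M = (\<Pi>\<^sub>E i\<in>UNIV. if i = z then {..<m} else {..<M})"

lemma grid_point_nth [simp]:
  "grid_point z \<delta> D f $ i = (if i = z then height D (f i) else \<delta> * real (f i))"
  by (simp add: grid_point_def)

lemma height_simps [simp]: "height D (2 * j) = real j * D" "height D (Suc (2 * j)) = real j * D + 1"
  by (simp_all add: height_def)

text \<open>The gaps alternate between 1 inside a pair of layers and \<open>D - 1\<close> between
  consecutive pairs.\<close>

lemma height_Suc_diff: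
  assumes "D > 1" shows "0 < height D (Suc m) - height D m" "height D (Suc m) - height D m \<le> D"
proof -
  consider j where "m = 2 * j" | j where "m = Suc (2 * j)"
    by (metis evenE oddE Suc_eq_plus1)
  then have "height D (Suc m) - height D m \<in> {1, D - 1}"
  proof cases
    case 2
    then have "Suc m = 2 * Suc j" by simp
    with 2 show ?thesis by (simp only: height_simps) (simp add: algebra_simps)
  qed simp
  with assms show "0 < height D (Suc m) - height D m" "height D (Suc m) - height D m \<le> D" by auto
qed

lemma height_inj: "D > 1 \<Longrightarrow> inj (height D)"
  using height_Suc_diff(1) by (intro strict_mono_imp_inj_on) (auto simp: strict_mono_Suc_iff)

section \<open>Size of the stacked grids and a cheap spanning tree\<close>

lemma mem_grid_index:
  "f \<in> grid_index z m M \<longleftrightarrow> f z < m \<and> (\<forall>i. i \<noteq> z \<longrightarrow> f i < M)"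
  unfolding grid_index_def PiE_iff by auto

lemma finite_grid_index: "finite (grid_index (z::'d::finite) m M)"
  unfolding grid_index_def by (rule finite_PiE) auto

lemma card_grid_index: "card (grid_index (z::'d::finite) m M) = m * M ^ (CARD('d) - 1)"
proof -
  have "card (grid_index z m M) = (\<Prod>i\<in>UNIV. card (if i = z then {..<m} else {..<M}))"
    unfolding grid_index_def by (rule card_PiE) simp
  also have "\<dots> = m * (\<Prod>i\<in>UNIV - {z}. card (if i = z then {..<m} else {..<M}))"
    by (subst prod.remove[of _ z]) auto
  also have "(\<Prod>i\<in>UNIV - {z}. card (if i = z then {..<m} else {..<M})) = (\<Prod>i\<in>UNIV - {z}. M)"
    by (rule prod.cong) auto
  finally show ?thesis by simp
qed

lemma inj_grid_point:
  assumes "0 < \<delta>" "1 < D" shows "inj (grid_point (z::'d::finite) \<delta> D)"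
proof (rule injI, rule ext)
  fix f g i assume "grid_point z \<delta> D f = grid_point z \<delta> D g"
  then have "grid_point z \<delta> D f $ i = grid_point z \<delta> D g $ i" by simp
  then show "f i = g i"
    using assms height_inj[OF assms(2)] by (auto simp: inj_eq split: if_splits)
qed

lemma dist_grid_point_decr:
  assumes "0 < \<delta>" "1 < D" "f i > 0"
  shows "dist (grid_point z \<delta> D f) (grid_point (z::'d::finite) \<delta> D (f(i := f i - 1)))
    \<le> (if i = z then D else \<delta>)"
proof -
  let ?c = "if i = z then height D (f i) - height D (f i - 1) else \<delta>"
  have "grid_point z \<delta> D f - grid_point z \<delta> D (f(i := f i - 1)) = axis i ?c"
    using assms(3) by (auto simp: vec_eq_iff axis_def of_nat_diff algebra_simps)
  then have "dist (grid_point z \<delta> D f) (grid_point z \<delta> D (f(i := f i - 1))) = \<bar>?c\<bar>"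
    by (simp only: dist_norm norm_eq_sqrt_inner inner_axis_axis) simp
  also have "\<dots> \<le> (if i = z then D else \<delta>)"
    using height_Suc_diff[OF assms(2), of "f i - 1"] assms by auto
  finally show ?thesis .
qed

text \<open>A comb: each point first moves within its layer towards the vertical axis at cost
  \<open>\<delta>\<close> per step, and only points on the axis step down at cost up to
  \<open>D\<close>. Thus the large cost \<open>D\<close> is paid at most once per layer.\<close>

lemma grid_spanning_tree:
  fixes z :: "'d::finite"
  assumes "0 < \<delta>" "1 < D" "0 < m" "0 < M"
  shows "\<exists>T. spanning_tree (grid_point z \<delta> D ` grid_index z m M) T \<and>
    graph_weight T \<le> real (m * M ^ (CARD('d) - 1)) * \<delta> + real m * D"
proof -
  let ?I = "grid_index z m M" and ?P = "grid_point z \<delta> D"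
  define r where "r = (\<lambda>_::'d. 0::nat)"
  define hor where "hor = (\<lambda>f::'d \<Rightarrow> nat. \<exists>i. i \<noteq> z \<and> f i > 0)"
  define ix where "ix = (\<lambda>f. if hor f then SOME i. i \<noteq> z \<and> f i > 0 else z)"
  define par where "par = (\<lambda>f. f(ix f := f (ix f) - 1))"
  define c where "c = (\<lambda>f. if hor f then \<delta> else D)"
  have "\<exists>T. spanning_tree (?P ` ?I) T \<and> graph_weight T \<le> (\<Sum>f\<in>?I - {r}. c f)"
  proof (rule spanning_tree_of_parents[where par = par and rank = "\<lambda>f. \<Sum>i\<in>UNIV. f i"])
    show "inj_on ?P ?I" using inj_grid_point[OF assms(1,2)] by (rule inj_on_subset) simp
    show "r \<in> ?I" using assms by (simp add: r_def mem_grid_index)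
    fix f assume f: "f \<in> ?I - {r}"
    have ix: "f (ix f) > 0 \<and> (ix f = z \<longleftrightarrow> \<not> hor f)"
    proof (cases "hor f")
      case True
      then have "ix f \<noteq> z \<and> f (ix f) > 0"
        using someI_ex[of "\<lambda>i. i \<noteq> z \<and> f i > 0"] unfolding ix_def hor_def by auto
      with True show ?thesis by simp
    next
      case False
      obtain i where "f i \<noteq> 0" using f by (auto simp: r_def)
      then have "f z > 0" using False unfolding hor_def by (cases "i = z") auto
      with False show ?thesis by (simp add: ix_def)
    qed
    have "(\<Sum>i\<in>UNIV. par f i) < (\<Sum>i\<in>UNIV. f i)"
      using ix by (intro sum_strict_mono_ex1) (auto simp: par_def)
    moreover have "par f \<in> ?I" using f by (auto simp: mem_grid_index par_def less_imp_diff_less)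
    moreover have "dist (?P f) (?P (par f)) \<le> c f"
      using dist_grid_point_decr[OF assms(1,2), of f "ix f" z] ix by (auto simp: par_def c_def)
    ultimately show "par f \<in> ?I \<and> (\<Sum>i\<in>UNIV. par f i) < (\<Sum>i\<in>UNIV. f i) \<and> dist (?P f) (?P (par f)) \<le> c f"
      by blast
  qed (rule finite_grid_index)
  then obtain T where T: "spanning_tree (?P ` ?I) T" "graph_weight T \<le> (\<Sum>f\<in>?I - {r}. c f)" by blast
  let ?J = "{f \<in> ?I. \<not> hor f}"
  \<comment> \<open>Indices that are not \<open>hor\<close> vanish off \<open>z\<close> and are
    determined by their layer, so at most \<open>m\<close> points pay \<open>D\<close>.\<close>
  have "?J \<subseteq> (\<lambda>j. r(z := j)) ` {..<m}"
  proof
    fix f assume "f \<in> ?J"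
    then have "f = r(z := f z)" "f z < m" by (auto simp: hor_def r_def fun_eq_iff mem_grid_index)
    then show "f \<in> (\<lambda>j. r(z := j)) ` {..<m}" by blast
  qed
  then have "card ?J \<le> m" using surj_card_le[of "{..<m}"] by fastforce
  have "(\<Sum>f\<in>?I - {r}. c f) \<le> (\<Sum>f\<in>?I. c f)"
    using assms finite_grid_index by (intro sum_mono2) (auto simp: c_def)
  also have "\<dots> \<le> (\<Sum>f\<in>?I. \<delta> + (if hor f then 0 else D))"
    using assms by (intro sum_mono) (auto simp: c_def)
  also have "\<dots> = real (card ?I) * \<delta> + real (card ?J) * D"
  proof -
    have "?I \<inter> - {f. hor f} = ?J" by auto
    then show ?thesis
      using finite_grid_index[of z m M] by (simp add: sum.distrib sum.If_cases)
  qed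
  also have "\<dots> \<le> real (card ?I) * \<delta> + real m * D"
    using \<open>card ?J \<le> m\<close> assms by simp
  finally show ?thesis using T card_grid_index[of z m M] by force
qed

section \<open>Lower bounds for a spanner of the stacked grids\<close>

lemma norm_cart_le_card:
  fixes x :: "real^'d" assumes "\<And>i. \<bar>x $ i\<bar> \<le> 1" shows "norm x \<le> real CARD('d)"
proof -
  have "norm x \<le> (\<Sum>i\<in>UNIV. \<bar>x $ i\<bar>)" by (rule norm_le_l1_cart)
  also have "\<dots> \<le> (\<Sum>i\<in>(UNIV::'d set). 1)" using assms by (rule sum_mono)
  finally show ?thesis by simp
qed

lemma grid_layer_separated:
  fixes z :: "'d::finite"
  assumes "a \<in> grid_index z 1 M" "a' \<in> grid_index z 1 M" "0 < \<delta>"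
    and "dist (grid_point z \<delta> D (a(z := m))) (grid_point z \<delta> D (a'(z := m))) < \<delta>"
  shows "a = a'"
proof
  fix i
  show "a i = a' i"
  proof (cases "i = z")
    case True then show ?thesis using assms by (simp add: mem_grid_index)
  next
    case False
    have "\<bar>(grid_point z \<delta> D (a(z := m)) - grid_point z \<delta> D (a'(z := m))) $ i\<bar> < \<delta>"
      using assms(4) component_le_norm_cart order_le_less_trans unfolding dist_norm by blast
    then have "\<delta> * \<bar>real (a i) - real (a' i)\<bar> < \<delta> * 1"
      using False assms(3) by (simp add: right_diff_distrib[symmetric] abs_mult)
    then have "\<bar>real (a i) - real (a' i)\<bar> < 1" using assms(3) by (simp only: mult_less_cancel_left_pos)
    then show ?thesis by linarith
  qed
qed

text \<open>Each bottom-top pair of points in each pair of layers charges the aligned steps of its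
  walk, of total length at least 3/4, and no directed step is charged twice. Halving for orientation
  gives 3/8. No step is longer than \<open>3 * d\<close>, which turns length into a count and yields
  the factor \<open>1 / (8 * d)\<close>.\<close>

lemma grid_spanner_bounds:
  fixes z :: "'d::finite" and S :: "(real^'d) set"
  defines "d \<equiv> real CARD('d)"
  assumes sp: "steiner_spanner S eps V E" and eps: "0 < eps" "eps \<le> 1"
    and \<delta>: "\<delta> = 24 * d * (1 + d)\<^sup>2 * sqrt eps" "(real M - 1) * \<delta> \<le> 1"
    and sub: "grid_point z \<delta> (8 * d) ` grid_index z (2 * k) M \<subseteq> S"
  shows "3 / 8 * real (k * (M ^ (CARD('d) - 1))\<^sup>2) \<le> graph_weight E"
    and "real (k * (M ^ (CARD('d) - 1))\<^sup>2) / (8 * d) \<le> real (card E)"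
proof -
  let ?P = "grid_point z \<delta> (8 * d)" and ?H = "grid_index z 1 M" and ?N = "M ^ (CARD('d) - 1)"
  define bot where "bot = (\<lambda>(j, a::'d \<Rightarrow> nat, b::'d \<Rightarrow> nat). ?P (a(z := 2 * j)))"
  define top where "top = (\<lambda>(j, a::'d \<Rightarrow> nat, b). ?P (b(z := Suc (2 * j))))"
  define X where "X = {..<k} \<times> ?H \<times> ?H"
  have d1: "1 \<le> d" unfolding d_def by (simp add: Suc_leI)
  have \<delta>0: "0 < \<delta>" unfolding \<delta> using d1 eps by simp
  have XS: "bot t \<in> S" "top t \<in> S" if tX: "t \<in> X" for t
  proof -
    obtain j a b where t: "t = (j, a, b)" "j < k" "a \<in> ?H" "b \<in> ?H"
      using tX unfolding X_def by blast
    then have "a(z := 2 * j) \<in> grid_index z (2 * k) M" "b(z := Suc (2 * j)) \<in> grid_index z (2 * k) M"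
      by (auto simp: mem_grid_index)
    then show "bot t \<in> S" "top t \<in> S" using sub t by (auto simp: bot_def top_def)
  qed
  \<comment> \<open>All segments have vertical extent exactly 1, so \<open>axis z 1\<close> can
    serve as the vector \<open>e\<close> of the geometric lemmas.\<close>
  have vert: "(top t - bot t) $ z = 1" for t
    by (cases t) (simp add: bot_def top_def)
  have ge1: "1 \<le> dist (bot t) (top t)" for t
    using component_le_norm_cart[of "top t - bot t" z] vert[of t] by (simp add: dist_norm norm_minus_commute)
  have le: "dist (bot t) (top t) \<le> d" if tX: "t \<in> X" for t
  proof -
    obtain j a b where t: "t = (j, a, b)" "j < k" "a \<in> ?H" "b \<in> ?H"
      using tX unfolding X_def by blast
    have "\<bar>(top t - bot t) $ i\<bar> \<le> 1" for i
    proof (cases "i = z")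
      case False
      then have "a i < M" "b i < M" using t by (auto simp: mem_grid_index)
      then have "\<bar>real (b i) - real (a i)\<bar> \<le> real M - 1" by linarith
      then have "\<bar>real (b i) - real (a i)\<bar> * \<delta> \<le> (real M - 1) * \<delta>"
        using \<delta>0 by (intro mult_right_mono) auto
      moreover have "\<bar>(top t - bot t) $ i\<bar> = \<bar>real (b i) - real (a i)\<bar> * \<delta>"
        using False \<delta>0 by (simp add: t bot_def top_def left_diff_distrib[symmetric] abs_mult mult.commute[of \<delta>])
      ultimately show ?thesis using \<delta>(2) by linarith
    next
      case True
      then show ?thesis by (simp only: vert abs_one order_refl)
    qed
    then show ?thesis
      using norm_cart_le_card[of "top t - bot t"] by (simp add: d_def dist_norm norm_minus_commute)
  qed
  have "\<exists>p. is_walk E p \<and> distinct p \<and> hd p = bot t \<and> last p = top t \<and>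
      walk_len p \<le> (1 + 2 * eps) * dist (bot t) (top t)" if tX: "t \<in> X" for t
  proof -
    have "bot t \<noteq> top t" using ge1[of t] by auto
    then show ?thesis
      using steiner_spanner_walk[OF sp XS(1)[OF that] XS(2)[OF that] _ eps(1)] by metis
  qed
  then obtain W where W: "\<And>t. t \<in> X \<Longrightarrow> is_walk E (W t) \<and> distinct (W t) \<and> hd (W t) = bot t \<and>
      last (W t) = top t \<and> walk_len (W t) \<le> (1 + 2 * eps) * dist (bot t) (top t)"
    by metis
  have len: "walk_len (W t) \<le> 3 * d" if tX: "t \<in> X" for t
  proof -
    have "(1 + 2 * eps) * dist (bot t) (top t) \<le> 3 * d"
      using le[OF that] eps by (intro mult_mono) auto
    then show ?thesis using W[OF that] by linarith
  qed
  define G where "G = (\<lambda>t. aligned_steps eps (top t - bot t) (W t))"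
  have Gsub: "G t \<subseteq> steps (W t)" for t by (auto simp: G_def aligned_steps_def)
  then have Gfin: "finite (G t)" for t by (rule finite_subset) (rule finite_steps)
  have ne: "W t \<noteq> []" if "t \<in> X" for t using W[OF that] by auto
  have Glen: "3 / 4 \<le> (\<Sum>(x, y)\<in>G t. dist x y)" if tX: "t \<in> X" for t
  proof -
    have "3 / 4 * dist (bot t) (top t) \<le> (\<Sum>(x, y)\<in>G t. dist x y)"
      unfolding G_def using W[OF that] ne[OF that] eps(1) by (intro aligned_steps_length) blast+
    then show ?thesis using ge1[of t] by linarith
  qed
  \<comment> \<open>Walks are no longer than \<open>3 * d\<close> while pairs of layers are
    \<open>8 * d\<close> apart, so a step reveals the pair of layers whose walk uses it.\<close>
  have near: "\<bar>x $ z - real (fst t) * (8 * d)\<bar> \<le> 3 * d" if "t \<in> X" "(x, y) \<in> G t" for t x y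
  proof -
    have "x \<in> set (W t)" using that(2) Gsub steps_in_set by fastforce
    then have "dist (bot t) x + dist x (top t) \<le> walk_len (W t)"
      using dist_via_vertex_le_walk_len[of x "W t"] W[OF that(1)] by simp
    then have "dist (bot t) x \<le> 3 * d"
      using len[OF that(1)] zero_le_dist[of x "top t"] by linarith
    moreover have "bot t $ z = real (fst t) * (8 * d)" by (cases t) (simp add: bot_def)
    ultimately show ?thesis
      using component_le_norm_cart[of "x - bot t" z] by (simp add: dist_norm norm_minus_commute)
  qed
  have disj: "t = t'" if t: "t \<in> X" "t' \<in> X" and s: "(x, y) \<in> G t" "(x, y) \<in> G t'" for t t' x y
  proof -
    obtain j a b j' a' b' where tt: "t = (j, a, b)" "t' = (j', a', b')"
      "a \<in> ?H" "b \<in> ?H" "a' \<in> ?H" "b' \<in> ?H"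
      using t unfolding X_def by blast
    have "\<bar>real j * (8 * d) - real j' * (8 * d)\<bar> \<le> 6 * d"
      using near[OF t(1) s(1)] near[OF t(2) s(2)] tt by simp
    moreover have "\<bar>real j * (8 * d) - real j' * (8 * d)\<bar> = \<bar>real j - real j'\<bar> * (8 * d)"
      using d1 by (simp add: left_diff_distrib[symmetric] abs_mult)
    ultimately have "\<bar>real j - real j'\<bar> * (8 * d) \<le> 6 * d" by simp
    then have "\<bar>real j - real j'\<bar> * (8 * d) < 1 * (8 * d)" using d1 by linarith
    then have "\<bar>real j - real j'\<bar> < 1" using d1 by (subst (asm) mult_less_cancel_right_pos) simp_all
    then have jj: "j = j'" by linarith
    \<comment> \<open>Only now, within one pair of layers, do both segments start at equal height as
      the closeness lemma requires. Its bound with \<open>B = d\<close> is exactly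
      \<open>\<delta>\<close>.\<close>
    have "bot t $ z = bot t' $ z" by (simp add: bot_def tt jj)
    then have "dist (bot t) (bot t') < \<delta>" "dist (top t) (top t') < \<delta>"
      using aligned_steps_endpoints_close[of "W t" "bot t" "top t" eps "W t'" "bot t'" "top t'"
        x y "axis z 1" d] W[OF t(1)] W[OF t(2)] s eps vert le[OF t(1)] le[OF t(2)] d1
        inner_axis'[of z 1 "top t - bot t"] inner_axis'[of z 1 "top t' - bot t'"]
      unfolding G_def \<delta>(1) vert by (auto simp: inner_axis')
    then have "a = a'" "b = b'"
      using grid_layer_separated[of a z M a' \<delta> "8 * d" "2 * j"]
        grid_layer_separated[of b z M b' \<delta> "8 * d" "Suc (2 * j)"] \<delta>0 tt jj
      by (auto simp: bot_def top_def)
    then show ?thesis using tt jj by simp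
  qed
  have Xfin: "finite X" unfolding X_def using finite_grid_index by blast
  have Xcard: "card X = k * ?N\<^sup>2"
    by (simp add: X_def card_cartesian_product card_grid_index power2_eq_square)
  define U where "U = (\<Union>t\<in>X. G t)"
  have "(\<Sum>(x, y)\<in>U. dist x y) = (\<Sum>t\<in>X. \<Sum>(x, y)\<in>G t. dist x y)"
    unfolding U_def using Xfin Gfin disj by (intro sum.UNION_disjoint) auto
  also have "\<dots> \<ge> (\<Sum>t\<in>X. 3 / 4)" by (rule sum_mono) (rule Glen)
  finally have Ulen: "3 / 4 * real (k * ?N\<^sup>2) \<le> (\<Sum>(x, y)\<in>U. dist x y)"
    using Xcard by simp
  have UE: "U \<subseteq> {(x, y). {x, y} \<in> E}"
    unfolding U_def using Gsub W steps_edge by fastforce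
  have geom: "geom_graph V E" using sp by (simp add: steiner_spanner_def)
  have Efin: "finite E" using geom_graph_finite geom by blast
  have "edge_len e \<ge> 0" if "e \<in> E" for e
    using that geom by (auto simp: geom_graph_def edge_len_pair)
  then have "(\<Sum>(x, y)\<in>U. edge_len {x, y}) \<le> 2 * graph_weight E"
    unfolding graph_weight_def by (intro sum_directed_le[OF Efin UE]) auto
  then show "3 / 8 * real (k * ?N\<^sup>2) \<le> graph_weight E"
    using Ulen by (simp add: edge_len_pair)
  have "dist x y \<le> 3 * d" if xy: "(x, y) \<in> U" for x y
  proof -
    obtain t where t: "t \<in> X" "(x, y) \<in> steps (W t)" using xy Gsub unfolding U_def by blast
    have "(\<lambda>(x, y). dist x y) (x, y) \<le> (\<Sum>(x, y)\<in>steps (W t). dist x y)"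
      by (rule member_le_sum) (use t in auto)
    then show ?thesis using sum_steps_dist[of "W t"] W[OF t(1)] len[OF t(1)] by simp
  qed
  then have "(\<Sum>(x, y)\<in>U. dist x y) \<le> (\<Sum>(x, y)\<in>U. 3 * d)" by (intro sum_mono) auto
  also have "\<dots> = 3 * d * (\<Sum>(x, y)\<in>U. 1)" by (simp add: case_prod_unfold)
  also have "\<dots> \<le> 3 * d * (2 * (\<Sum>e\<in>E. 1))"
    using sum_directed_le[OF Efin UE, of "\<lambda>_. 1"] d1 by (intro mult_left_mono) auto
  finally have "3 / 4 * real (k * ?N\<^sup>2) \<le> 6 * d * real (card E)" using Ulen by simp
  then show "real (k * ?N\<^sup>2) / (8 * d) \<le> real (card E)" using d1 by (simp add: field_simps)
qed

section \<open>Choice of parameters and final estimates\<close>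

theorem theorem1:
  assumes "CARD('d::finite) \<ge> 2"
  shows "\<exists>c1 c2 c3 :: real. c1 > 0 \<and> c2 > 0 \<and> c3 > 0 \<and>
    (\<forall>(eps::real) (n::nat). 0 < eps \<and> eps \<le> 1 \<and>
        real n \<ge> c1 * eps powr ((1 - real CARD('d)) / 2) \<longrightarrow>
      (\<exists>S :: (real^'d) set. finite S \<and> card S = n \<and>
        (\<forall>V E. steiner_spanner S eps V E \<longrightarrow>
           lightness S E \<ge> c2 * eps powr (- real CARD('d) / 2) \<and>
           sparsity S E \<ge> c3 * eps powr ((1 - real CARD('d)) / 2))))"
proof -
  let ?m = "CARD('d)"
  define d where "d = real ?m"
  \<comment> \<open>\<open>K * sqrt eps\<close> is the separation bound for segments of length at
    most \<open>d\<close>. In \<open>C\<close>, the 4 pays for horizontal and padding edges and the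
    other term absorbs the vertical edges.\<close>
  define K where "K = 24 * d * (1 + d)\<^sup>2"
  define C where "C = 4 + 16 * d * K ^ (?m - 2)"
  define c2 where "c2 = 3 / (8 * C * K ^ ?m)"
  define c3 where "c3 = 1 / (32 * d * K ^ (?m - 1))"
  have d2: "2 \<le> d" using assms by (simp add: d_def)
  have "24 * d * 1 \<le> K" unfolding K_def using d2 by (intro mult_left_mono) auto
  then have K1: "1 \<le> K" using d2 by linarith
  have C0: "0 < C" unfolding C_def using d2 K1 by (intro add_pos_nonneg) auto
  \<comment> \<open>The first value is the witness for the constant in the bound on
    \<open>n\<close>: since \<open>N\<close> is at most \<open>(2 * q) ^ (?m - 1)\<close>, it
    guarantees room for one full pair of layers, \<open>2 * N\<close> points.\<close>
  have pos: "0 < 2 * (2::real) ^ (?m - 1)" "0 < c2" "0 < c3"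
    using d2 K1 C0 by (auto simp: c2_def c3_def)
  have "\<exists>S :: (real^'d) set. finite S \<and> card S = n \<and>
        (\<forall>V E. steiner_spanner S eps V E \<longrightarrow>
           lightness S E \<ge> c2 * eps powr (- real ?m / 2) \<and>
           sparsity S E \<ge> c3 * eps powr ((1 - real ?m) / 2))"
    if eps: "0 < eps" "eps \<le> 1" and n: "real n \<ge> 2 * 2 ^ (?m - 1) * eps powr ((1 - real ?m) / 2)"
    for eps :: real and n :: nat
  proof -
    define q where "q = 1 / sqrt eps"
    define \<delta> where "\<delta> = K * sqrt eps"
    \<comment> \<open>The number of multiples of \<open>\<delta>\<close> in the unit interval; it is
      at least 1 even if \<open>\<delta>\<close> exceeds 1.\<close>
    define M where "M = nat \<lfloor>1 / \<delta>\<rfloor> + 1"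
    define N where "N = M ^ (?m - 1)"
    define k where "k = n div (2 * N)"
    have q1: "1 \<le> q" unfolding q_def using eps by simp
    have q_pow: "q ^ i = eps powr (- real i / 2)" for i
      using eps by (simp add: q_def powr_half_sqrt[symmetric] powr_minus_divide[symmetric]
          powr_powr powr_realpow[symmetric] powr_gt_zero)
    have q_d: "eps powr (- real ?m / 2) = q ^ ?m" by (simp only: q_pow)
    have "- real (?m - 1) / 2 = (1 - real ?m) / 2" using assms by (simp add: of_nat_diff)
    then have q_d1: "eps powr ((1 - real ?m) / 2) = q ^ (?m - 1)" by (simp only: q_pow)
    have \<delta>0: "0 < \<delta>" using K1 eps by (simp add: \<delta>_def)
    have inv: "1 / \<delta> = q / K" by (simp add: \<delta>_def q_def)
    have fl: "0 \<le> \<lfloor>1 / \<delta>\<rfloor>" using \<delta>0 by simp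
    then have M: "real M = of_int \<lfloor>1 / \<delta>\<rfloor> + 1" by (simp add: M_def)
    then have M_lower: "q / K \<le> real M" unfolding inv[symmetric] by linarith
    have "real M - 1 \<le> 1 / \<delta>" unfolding M by linarith
    then have M_upper: "(real M - 1) * \<delta> \<le> 1" using \<delta>0 by (simp add: field_simps)
    have "q / K \<le> q" using q1 K1 by (simp add: field_simps)
    then have M_le: "real M \<le> 2 * q" using \<open>real M - 1 \<le> 1 / \<delta>\<close> q1 inv by linarith
    have M0: "0 < M" by (simp add: M_def)
    then have N0: "0 < N" by (simp add: N_def)
    have N_lower: "(q / K) ^ (?m - 1) \<le> real N"
      unfolding N_def of_nat_power using M_lower q1 K1 by (intro power_mono) auto
    have "real N \<le> (2 * q) ^ (?m - 1)"
      unfolding N_def of_nat_power using M_le by (intro power_mono) auto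
    then have "real (2 * N) \<le> real n" using n unfolding q_d1 by (simp add: power_mult_distrib)
    then have Nn: "2 * N \<le> n" by linarith
    then have k0: "0 < k" using N0 by (simp add: k_def div_greater_zero_iff)
    have n_div: "n = 2 * N * k + n mod (2 * N)" by (simp add: k_def)
    \<comment> \<open>The points left over number at most as many as the grid points, so padding at
      most doubles the horizontal cost.\<close>
    have "n mod (2 * N) < 2 * N" using N0 by simp
    moreover have "2 * N * 1 \<le> 2 * N * k" using k0 by (intro mult_left_mono) auto
    ultimately have r_le: "n mod (2 * N) \<le> 2 * N * k" by linarith
    define z :: 'd where "z = undefined"
    let ?G = "grid_point z \<delta> (8 * d) ` grid_index z (2 * k) M"
    have D: "1 < 8 * d" using d2 by simp
    obtain T where T: "spanning_tree ?G T" "graph_weight T \<le> real (2 * k * N) * \<delta> + real (2 * k) * (8 * d)"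
      using grid_spanning_tree[OF \<delta>0 D, of "2 * k" M z] k0 M0 unfolding N_def by auto
    have "card ?G = 2 * k * N"
      using card_image[OF inj_on_subset[OF inj_grid_point[OF \<delta>0 D]], of "grid_index z (2 * k) M" z]
      by (simp add: card_grid_index N_def)
    moreover have "finite ?G" using finite_grid_index by blast
    moreover have "?G \<noteq> {}" using \<open>card ?G = 2 * k * N\<close> k0 N0 by (metis card.empty mult_eq_0_iff not_gr_zero zero_neq_numeral)
    ultimately obtain S T' where S: "?G \<subseteq> S" "finite S" "card S = n" "spanning_tree S T'"
      "graph_weight T' \<le> graph_weight T + real (n mod (2 * N)) * \<delta>"
      using spanning_tree_add_points[OF T(1) _ _ \<delta>0, of "n mod (2 * N)"] n_div by (auto simp: mult_ac)
    have "real (n mod (2 * N)) * \<delta> \<le> real (2 * N * k) * \<delta>"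
      using \<delta>0 of_nat_mono[OF r_le] by (intro mult_right_mono) simp_all
    then have wT': "graph_weight T' \<le> 4 * (k * (N * \<delta>)) + 16 * d * k"
      using S(5) T(2) by (simp add: algebra_simps)
    \<comment> \<open>This absorbs the vertical cost \<open>16 * d * k\<close>: as
      \<open>(q / K) * \<delta> = 1\<close>, the product \<open>N * \<delta>\<close> is at least
      \<open>(q / K) ^ (?m - 2)\<close>. Here the dimension must be at least 2.\<close>
    have "1 \<le> q ^ (?m - 2)" using q1 by simp
    also have "\<dots> = K ^ (?m - 2) * ((q / K) ^ (?m - 2) * ((q / K) * \<delta>))"
      using K1 eps by (simp add: power_divide power_mult_distrib \<delta>_def q_def)
    also have "\<dots> = K ^ (?m - 2) * ((q / K) ^ (?m - 1) * \<delta>)"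
    proof -
      have "?m - 1 = Suc (?m - 2)" using assms by simp
      then show ?thesis by (simp only: power_Suc2 mult.assoc)
    qed
    also have "\<dots> \<le> K ^ (?m - 2) * (real N * \<delta>)"
      using N_lower \<delta>0 K1 by (intro mult_left_mono mult_right_mono) auto
    finally have "16 * d * k * 1 \<le> 16 * d * k * (K ^ (?m - 2) * (real N * \<delta>))"
      using d2 by (intro mult_left_mono) auto
    then have "graph_weight T' \<le> C * (k * (N * \<delta>))"
      using wT' by (simp add: C_def algebra_simps)
    moreover have n2: "2 \<le> n" using Nn N0 by linarith
    ultimately have mst: "0 < mst_weight S" "mst_weight S \<le> C * (k * (N * \<delta>))"
      using mst_weight_bounds[OF S(4,2)] S(3) by auto
    have "lightness S E \<ge> c2 * eps powr (- real ?m / 2) \<and>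
        sparsity S E \<ge> c3 * eps powr ((1 - real ?m) / 2)" if sp: "steiner_spanner S eps V E" for V E
    proof
      have bounds: "3 / 8 * real (k * N\<^sup>2) \<le> graph_weight E" "real (k * N\<^sup>2) / (8 * d) \<le> real (card E)"
        using grid_spanner_bounds[OF sp eps, of \<delta> M z k] M_upper S(1)
        unfolding N_def d_def[symmetric] K_def[symmetric] \<delta>_def by auto
      \<comment> \<open>In the quotient of weights \<open>k\<close> and one factor \<open>N\<close>
        cancel, leaving \<open>N / \<delta>\<close>; the factor \<open>1 / \<delta> = q / K\<close>
        raises the exponent from \<open>?m - 1\<close> to \<open>?m\<close>.\<close>
      have "c2 * q ^ ?m = 3 / (8 * C) * (q / K) ^ ?m" by (simp add: c2_def power_divide)
      also have "(q / K) ^ ?m = (q / K) ^ (?m - 1) * (q / K)"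
        using assms by (metis power_minus_mult zero_less_card_finite)
      also have "3 / (8 * C) * \<dots> \<le> 3 / (8 * C) * (real N * (q / K))"
        using N_lower q1 K1 C0 by (intro mult_left_mono mult_right_mono) auto
      also have "\<dots> = (3 / 8 * real (k * N\<^sup>2)) / (C * (k * (N * \<delta>)))"
        unfolding inv[symmetric] using k0 N0 C0 \<delta>0 by (simp add: power2_eq_square)
      also have "\<dots> \<le> graph_weight E / mst_weight S"
        by (rule frac_le[OF order_trans[OF _ bounds(1)] bounds(1) mst]) simp
      finally show "c2 * eps powr (- real ?m / 2) \<le> lightness S E" unfolding q_d lightness_def .
      \<comment> \<open>Here the denominator \<open>n - 1\<close> is at most
        \<open>4 * N * k\<close>, so one factor \<open>N\<close> survives and supplies the exponent
        \<open>?m - 1\<close>.\<close>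
      have "c3 * q ^ (?m - 1) = (q / K) ^ (?m - 1) / (32 * d)" by (simp add: c3_def power_divide)
      also have "\<dots> \<le> real N / (32 * d)"
        using N_lower d2 by (intro divide_right_mono) auto
      also have "\<dots> = (real (k * N\<^sup>2) / (8 * d)) / (4 * real (N * k))"
        using k0 N0 d2 by (simp add: power2_eq_square)
      also have "\<dots> \<le> real (card E) / (real n - 1)"
      proof (rule frac_le)
        have "real n \<le> 4 * real (N * k)" using n_div r_le by linarith
        then show "real n - 1 \<le> 4 * real (N * k)" by simp
      qed (use bounds(2) n2 in auto)
      finally show "c3 * eps powr ((1 - real ?m) / 2) \<le> sparsity S E"
        unfolding q_d1 sparsity_def S(3) .
    qed
    then show ?thesis using S by blast
  qed
  then show ?thesis using pos by blast
qed

end
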